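(* Let $\mathcal{X}$ be a finite set and let $\mathcal{G}$ be an undirected graph with vertex set $\mathcal{X}$ satisfying the Disjointness Condition. Let $\mathcal{C}$ be the set of maximal cliques (maximal complete subsets) of $\mathcal{G}$. Let $S$ be a proper, continuously differentiable, key $\mathcal{G}$-local scoring rule, let $S(x,\boldsymbol\alpha)$ denote its $0$-homogeneous extension to $\mathcal{X}\times\mathcal{A}$, let $\mathbf{S}(\boldsymbol\alpha)=(S(x,\boldsymbol\alpha):x\in\mathcal{X})$, and let $H(\boldsymbol\alpha)=\sum_{x}\alpha_x S(x,\boldsymbol\alpha)$ be the associated entropy function on $\mathcal{A}$. Then there exist functions $s_C\colon\mathcal{A}_C\to\mathbb{R}^{\mathcal{X}}$ and $h_C\colon\mathcal{A}_C\to\mathbb{R}$, $C\in\mathcal{C}$, such that for all $\boldsymbol\alpha\in\mathcal{A}$ $$\mathbf{S}(\boldsymbol\alpha)=\sum_{C\in\mathcal{C}}s_C(\boldsymbol\alpha_C),\qquad H(\boldsymbol\alpha)=\sum_{C\in\mathcal{C}}h_C(\boldsymbol\alpha_C).$$ Further, if $H$ is regular, then each term $h_C$ in the expansion of $H$ can be chosen to be $1$-homogeneous, i.e. $h_C(\lambda\boldsymbol\alpha_C)=\lambda h_C(\boldsymbol\alpha_C)$ for all $\lambda>0$ and $\boldsymbol\alpha_C\in\mathcal{A}_C$.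
   Context: $\mathcal{X}$ is a finite set; $\mathcal{A}$ is the set of real vectors $\boldsymbol\alpha=(\alpha_x : x\in\mathcal{X})$ with every $\alpha_x>0$; $\mathcal{P}=\{\mathbf{p}\in\mathcal{A}:\sum_x p_x=1\}$, identified with the strictly positive probability distributions $P$ on $\mathcal{X}$. For $C\subseteq\mathcal{X}$, $\boldsymbol\alpha_C=(\alpha_x:x\in C)$ and $\mathcal{A}_C=\{\boldsymbol\alpha_C:\boldsymbol\alpha\in\mathcal{A}\}$. A scoring rule is a function $S\colon\mathcal{X}\times\mathcal{P}\to\mathbb{R}$; with $S(P,Q)=\sum_x p_xS(x,Q)$ it is proper if $S(P,Q)\ge S(P,P)$ for all $P,Q\in\mathcal{P}$. Its $0$-homogeneous extension is $S(x,\boldsymbol\alpha)=S(x,\boldsymbol\alpha/\alpha_+)$, $\alpha_+=\sum_y\alpha_y$, for $\boldsymbol\alpha\in\mathcal{A}$. Throughout, $S(x,P)$ is assumed continuously differentiable on $\mathcal{P}$ for each $x$. Neighborhoods: for $x\in\mathcal{X}$, $N_x=\{x\}\cup\{y: y \text{ is adjacent to } x \text{ in }\mathcal{G}\}$. Elements $x,y$ are related, $x\sim y$, if $x,y\in N_z$ for some $z\in\mathcal{X}$; $\rho(x)=\{y: y\sim x\}$. The Disjointness Condition: there exist $y_1,y_2\in\mathcal{X}$ with $\rho(y_1)\cap\rho(y_2)=\varnothing$ and $\rho(y_1)\cup\rho(y_2)\ne\mathcal{X}$. $S$ is $\mathcal{G}$-local if for each $x$, $S(x,P)=s(x,\mathbf{p}_{N_x})$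 for some function $s(x,\cdot)$ of $\mathbf{p}_{N_x}=(p_z:z\in N_x)$. Under the Disjointness Condition every $N_x\neq\mathcal{X}$, so $s(x,\cdot)$ is a uniquely determined function on the open set $\{\mathbf{p}_{N_x}: p_z>0,\ \sum_{z\in N_x}p_z<1\}$; $\partial S(x,P)/\partial p_y$ denotes the partial derivative of $s(x,\mathbf{p}_{N_x})$ with respect to $p_y$ if $y\in N_x$, and is $0$ if $y\notin N_x$. A $\mathcal{G}$-local scoring rule is key $\mathcal{G}$-local if it satisfies the key equation $$\sum_{x}p_x\frac{\partial}{\partial p_y}S(x,P)=0\qquad\text{for all }P\in\mathcal{P},\ y\in\mathcal{X}.$$ The entropy function $H$ (concave and $1$-homogeneous on $\mathcal{A}$ since $S$ is proper) is regular if it is continuous on $\mathcal{A}$ and its closure as a concave function is finite on $\bar{\mathcal{A}}=\{\boldsymbol\alpha:\alpha_x\ge 0,\ x\in\mathcal{X}\}$; in other words, $H$ can be extended by continuity to have finite values for all $\boldsymbol\alpha\in\bar{\mathcal{A}}$. *)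

theory Defs
  imports "HOL-Analysis.Analysis"
begin

text \<open>
  The finite sample space is the universe of a type \<open>'a::finite\<close>; vectors indexed by it are
  elements of \<^typ>\<open>real ^ 'a\<close>.
\<close>

definition pos_vecs :: "(real ^ 'a::finite) set" where
  "pos_vecs = {\<alpha>. \<forall>x. \<alpha> $ x > 0}"

definition nonneg_vecs :: "(real ^ 'a::finite) set" where
  "nonneg_vecs = {\<alpha>. \<forall>x. \<alpha> $ x \<ge> 0}"

lemma pos_vecs_subset_nonneg_vecs: "pos_vecs \<subseteq> nonneg_vecs"
  by (auto simp: pos_vecs_def nonneg_vecs_def less_imp_le)

definition pos_probs :: "(real ^ 'a::finite) set" where
  "pos_probs = {p \<in> pos_vecs. (\<Sum>x\<in>UNIV. p $ x) = 1}"

text \<open>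
  A subvector indexed by \<open>C\<close> is an extensional function on \<open>C\<close> (equal to \<^term>\<open>undefined\<close>
  off \<open>C\<close>), so that a function applied to \<open>subvec \<alpha> C\<close> depends on the
  coordinates in \<open>C\<close> only.
\<close>

definition subvec :: "real ^ 'a::finite \<Rightarrow> 'a set \<Rightarrow> 'a \<Rightarrow> real" where
  "subvec \<alpha> C = (\<lambda>x\<in>C. \<alpha> $ x)"

definition pos_subvecs :: "'a::finite set \<Rightarrow> ('a \<Rightarrow> real) set" where
  "pos_subvecs C = (\<lambda>\<alpha>. subvec \<alpha> C) ` pos_vecs"


section \<open>Graphs, given by an adjacency relation on the universe\<close>

definition nbhd :: "('a \<Rightarrow> 'a \<Rightarrow> bool) \<Rightarrow> 'a \<Rightarrow> 'a set" where
  "nbhd E x = {x} \<union> {y. E x y}"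

definition related :: "('a \<Rightarrow> 'a \<Rightarrow> bool) \<Rightarrow> 'a \<Rightarrow> 'a \<Rightarrow> bool" where
  "related E x y \<longleftrightarrow> (\<exists>z. x \<in> nbhd E z \<and> y \<in> nbhd E z)"

definition rho :: "('a \<Rightarrow> 'a \<Rightarrow> bool) \<Rightarrow> 'a \<Rightarrow> 'a set" where
  "rho E x = {y. related E y x}"

definition disjointness_condition :: "('a \<Rightarrow> 'a \<Rightarrow> bool) \<Rightarrow> bool" where
  "disjointness_condition E \<longleftrightarrow>
     (\<exists>y1 y2. rho E y1 \<inter> rho E y2 = {} \<and> rho E y1 \<union> rho E y2 \<noteq> UNIV)"

definition complete_subset :: "('a \<Rightarrow> 'a \<Rightarrow> bool) \<Rightarrow> 'a set \<Rightarrow> bool" where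
  "complete_subset E C \<longleftrightarrow> (\<forall>x\<in>C. \<forall>y\<in>C. x \<noteq> y \<longrightarrow> E x y)"

definition max_cliques :: "('a \<Rightarrow> 'a \<Rightarrow> bool) \<Rightarrow> 'a set set" where
  "max_cliques E =
     {C. complete_subset E C \<and> (\<forall>D. complete_subset E D \<and> C \<subseteq> D \<longrightarrow> D = C)}"


section \<open>Scoring rules\<close>

text \<open>
  A scoring rule is a function \<open>S :: 'a \<Rightarrow> real ^ 'a \<Rightarrow> real\<close> of which only the values \<open>S x p\<close>
  with \<open>p \<in> pos_probs\<close> matter; none of the notions below depends on any other values.
\<close>

definition expected_score ::
    "('a::finite \<Rightarrow> real ^ 'a \<Rightarrow> real) \<Rightarrow> real ^ 'a \<Rightarrow> real ^ 'a \<Rightarrow> real" where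
  "expected_score S p q = (\<Sum>x\<in>UNIV. p $ x * S x q)"

definition proper_score :: "('a::finite \<Rightarrow> real ^ 'a \<Rightarrow> real) \<Rightarrow> bool" where
  "proper_score S \<longleftrightarrow>
     (\<forall>p\<in>pos_probs. \<forall>q\<in>pos_probs. expected_score S p q \<ge> expected_score S p p)"

text \<open>
  The set \<^term>\<open>pos_probs\<close> is open in its affine hull but not in the ambient space, so the
  derivative is taken within it. It is determined on tangent vectors (those with zero
  coordinate sum) only; a choice continuous in \<open>p\<close> exists iff the tangential derivative is
  continuous, as one may compose with a linear projection onto the tangent space.
\<close>

definition cont_diff_score :: "('a::finite \<Rightarrow> real ^ 'a \<Rightarrow> real) \<Rightarrow> bool" where
  "cont_diff_score S \<longleftrightarrow>
     (\<forall>x. \<exists>D :: real ^ 'a \<Rightarrow> (real ^ 'a) \<Rightarrow>\<^sub>L real.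
        continuous_on pos_probs D \<and>
        (\<forall>p\<in>pos_probs. (S x has_derivative blinfun_apply (D p)) (at p within pos_probs)))"

definition local_repr ::
    "('a::finite \<Rightarrow> 'a \<Rightarrow> bool) \<Rightarrow> ('a \<Rightarrow> real ^ 'a \<Rightarrow> real) \<Rightarrow> ('a \<Rightarrow> ('a \<Rightarrow> real) \<Rightarrow> real) \<Rightarrow> bool"
  where
  "local_repr E S s \<longleftrightarrow> (\<forall>x. \<forall>p\<in>pos_probs. S x p = s x (subvec p (nbhd E x)))"

definition local_partial ::
    "('a::finite \<Rightarrow> 'a \<Rightarrow> bool) \<Rightarrow> ('a \<Rightarrow> ('a \<Rightarrow> real) \<Rightarrow> real) \<Rightarrow> 'a \<Rightarrow> 'a \<Rightarrow> real ^ 'a \<Rightarrow> real"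
  where
  "local_partial E s x y p =
     (if y \<in> nbhd E x
      then deriv (\<lambda>t. s x ((subvec p (nbhd E x))(y := t))) (p $ y)
      else 0)"

text \<open>
  When no neighbourhood is the whole space, as under the disjointness condition, \<open>s x\<close> is
  determined by \<open>S\<close> near \<open>subvec p (nbhd E x)\<close> for every \<open>p \<in> pos_probs\<close>, so the key
  equation does not depend on the representation \<open>s\<close>.
\<close>

definition key_local ::
    "('a::finite \<Rightarrow> 'a \<Rightarrow> bool) \<Rightarrow> ('a \<Rightarrow> real ^ 'a \<Rightarrow> real) \<Rightarrow> bool" where
  "key_local E S \<longleftrightarrow>
     (\<exists>s. local_repr E S s \<and>
        (\<forall>p\<in>pos_probs. \<forall>y. (\<Sum>x\<in>UNIV. p $ x * local_partial E s x y p) = 0))"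

definition hom_ext :: "('a::finite \<Rightarrow> real ^ 'a \<Rightarrow> real) \<Rightarrow> 'a \<Rightarrow> real ^ 'a \<Rightarrow> real" where
  "hom_ext S x \<alpha> = S x (\<alpha> /\<^sub>R (\<Sum>y\<in>UNIV. \<alpha> $ y))"

definition score_vec :: "('a::finite \<Rightarrow> real ^ 'a \<Rightarrow> real) \<Rightarrow> real ^ 'a \<Rightarrow> real ^ 'a" where
  "score_vec S \<alpha> = (\<chi> x. hom_ext S x \<alpha>)"

definition entropy :: "('a::finite \<Rightarrow> real ^ 'a \<Rightarrow> real) \<Rightarrow> real ^ 'a \<Rightarrow> real" where
  "entropy S \<alpha> = (\<Sum>x\<in>UNIV. \<alpha> $ x * hom_ext S x \<alpha>)"


section \<open>Regular entropy functions\<close>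

text \<open>
  The closure of a finite concave function \<open>f\<close> on \<open>A\<close> (extended by \<open>-\<infinity>\<close> off \<open>A\<close>) is its upper
  semicontinuous hull. At points of the closure of \<open>A\<close> this is the upper limit of \<open>f \<beta>\<close> as
  \<open>\<beta>\<close> tends to \<open>\<alpha>\<close> through \<open>A\<close>; as usual for hulls, \<open>\<beta> = \<alpha>\<close> is not excluded.
\<close>

definition concave_closure ::
    "'b::topological_space set \<Rightarrow> ('b \<Rightarrow> real) \<Rightarrow> 'b \<Rightarrow> ereal" where
  "concave_closure A f \<alpha> = Limsup (inf (nhds \<alpha>) (principal A)) (\<lambda>\<beta>. ereal (f \<beta>))"

definition regular_entropy :: "(real ^ 'a::finite \<Rightarrow> real) \<Rightarrow> bool" where
  "regular_entropy H \<longleftrightarrow>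
     continuous_on pos_vecs H \<and>
     (\<forall>\<alpha>\<in>nonneg_vecs. \<bar>concave_closure pos_vecs H \<alpha>\<bar> \<noteq> \<infinity>)"

text \<open>
  A function with a finite continuous extension to the closed orthant is regular. (For
  concave functions the converse holds as well, since the orthant is polyhedral.)
\<close>

lemma regular_entropy_if_continuous_extension:
  fixes H H' :: "real ^ 'a::finite \<Rightarrow> real"
  assumes cont: "continuous_on nonneg_vecs H'"
    and ext: "\<And>\<alpha>. \<alpha> \<in> pos_vecs \<Longrightarrow> H' \<alpha> = H \<alpha>"
  shows "regular_entropy H"
  unfolding regular_entropy_def
proof (intro conjI ballI)
  show "continuous_on pos_vecs H"
    using continuous_on_subset[OF cont pos_vecs_subset_nonneg_vecs] ext by (simp cong: continuous_on_cong)
next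
  fix \<alpha> :: "real ^ 'a"
  assume \<alpha>: "\<alpha> \<in> nonneg_vecs"
  define F where "F = inf (nhds \<alpha>) (principal (pos_vecs :: (real ^ 'a) set))"
  have "F \<noteq> bot"
  proof -
    have "(\<lambda>n. \<alpha> + (1 / real (Suc n)) *\<^sub>R (\<chi> x. 1)) \<longlonglongrightarrow> \<alpha> + 0 *\<^sub>R (\<chi> x. 1)"
      by (intro tendsto_intros LIMSEQ_Suc lim_1_over_n)
    moreover have "\<alpha> + (1 / real (Suc n)) *\<^sub>R (\<chi> x. 1) \<in> pos_vecs" for n
      using \<alpha> by (auto simp: pos_vecs_def nonneg_vecs_def intro: add_nonneg_pos)
    ultimately have "filterlim (\<lambda>n. \<alpha> + (1 / real (Suc n)) *\<^sub>R (\<chi> x. 1)) F sequentially"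
      by (simp add: F_def filterlim_inf filterlim_principal)
    then show ?thesis
      by (auto simp: filterlim_def filtermap_bot_iff bot_unique)
  qed
  moreover have "((\<lambda>\<beta>. ereal (H \<beta>)) \<longlongrightarrow> ereal (H' \<alpha>)) F"
  proof -
    have "(H' \<longlongrightarrow> H' \<alpha>) (inf (nhds \<alpha>) (principal nonneg_vecs))"
      using cont \<alpha> by (simp add: continuous_on_def tendsto_at_iff_tendsto_nhds_within)
    then have "(H' \<longlongrightarrow> H' \<alpha>) F"
      unfolding F_def by (rule tendsto_mono[rotated]) (intro inf_mono order_refl, simp add: pos_vecs_subset_nonneg_vecs)
    then have "(H \<longlongrightarrow> H' \<alpha>) F"
      by (rule tendsto_cong[THEN iffD1, rotated])
        (auto simp: F_def eventually_inf_principal ext)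
    then show ?thesis
      by (rule tendsto_ereal)
  qed
  ultimately have "concave_closure pos_vecs H \<alpha> = ereal (H' \<alpha>)"
    unfolding concave_closure_def F_def by (rule lim_imp_Limsup)
  then show "\<bar>concave_closure pos_vecs H \<alpha>\<bar> \<noteq> \<infinity>"
    by simp
qed

definition one_homogeneous_on :: "'a::finite set \<Rightarrow> (('a \<Rightarrow> real) \<Rightarrow> real) \<Rightarrow> bool" where
  "one_homogeneous_on C h \<longleftrightarrow>
     (\<forall>c>0. \<forall>\<beta>\<in>pos_subvecs C. h (\<lambda>x\<in>C. c * \<beta> x) = c * h \<beta>)"

end

theory Submission
  imports Defs
begin

text \<open>
  Write \<open>H\<close> for the entropy and \<open>S x\<close> for the \<open>0\<close>-homogeneous extension of the score at \<open>x\<close>. Propriety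
  says that \<open>\<beta> \<mapsto> \<Sum>\<^sub>x \<alpha>\<^sub>x S x \<beta>\<close> is minimal at \<open>\<beta> = \<alpha>\<close>, where its value is \<open>H \<alpha>\<close>. This makes \<open>H\<close> concave
  with gradient \<open>(S x)\<^sub>x\<close>, and since \<open>S\<close> is continuously differentiable the matrix of partial
  derivatives \<open>\<partial>\<^sub>y S x\<close> is symmetric.

  The crux (\<open>score_partial_nonadjacent\<close>) is that \<open>\<partial>\<^sub>y S x = 0\<close> whenever \<open>y\<close> lies outside the neighbourhood
  of \<open>x\<close>. This is not immediate from locality: \<open>S x \<alpha>\<close> depends on the coordinates of \<open>\<alpha>\<close> near \<open>x\<close> and,
  through normalisation, on the coordinate sum. So for fixed \<open>x\<close> the derivative is the same number
  \<open>- T\<^sub>x\<close> for all such \<open>y\<close>. Symmetry gives \<open>T\<^sub>x = T\<^sub>y\<close> for non-adjacent \<open>x\<close> and \<open>y\<close>. By the disjointness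
  condition there are \<open>y1\<close> and \<open>y2\<close> that are not adjacent and have no common neighbour, so each \<open>x\<close> is
  non-adjacent to one of them, and all \<open>T\<^sub>x\<close> equal one number \<open>\<tau>\<close>. On probability vectors the local partial
  derivative is \<open>\<partial>\<^sub>y S x + T\<^sub>x\<close>. Its \<open>p\<close>-average over \<open>x\<close> is \<open>0\<close> by the key equation, while the average of
  \<open>\<partial>\<^sub>y S x\<close> is \<open>0\<close> by minimality; hence \<open>\<tau> = 0\<close>.

  Consequently the mixed second differences of \<open>H\<close>, and of each \<open>S x\<close>, vanish for every pair of
  non-adjacent coordinates, and the expansion over maximal cliques is an argument of Hammersley-Clifford type
  (\<open>clique_expansion\<close>). Let \<open>F B \<alpha>\<close> be the value at the vector that agrees with \<open>\<alpha>\<close> on \<open>B\<close> and has a fixed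
  base value elsewhere. If \<open>y, z \<in> B\<close> are not adjacent, then
  \<open>F B = F (B - {y}) + F (B - {z}) - F (B - {y, z})\<close>, so \<open>F UNIV\<close> is a linear combination of the \<open>F B\<close> with
  \<open>B\<close> complete.

  A positive base value such as \<open>1\<close> breaks homogeneity of the terms; the base value \<open>0\<close> preserves it but
  leads to the boundary of the orthant. For regular \<open>H\<close> one lets the base value tend to \<open>0\<close>:
  along a segment that starts in a boundary point a concave function converges to its closure there
  (\<open>concave_limit_eq_closure\<close>), and this is finite by regularity.
\<close>

section \<open>Coordinate updates and normalisation\<close>

definition upd :: "real ^ 'a::finite \<Rightarrow> 'a \<Rightarrow> real \<Rightarrow> real ^ 'a" where
  "upd \<alpha> y b = (\<chi> i. if i = y then b else \<alpha> $ i)"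

definition mass :: "real ^ 'a::finite \<Rightarrow> real" where
  "mass \<alpha> = (\<Sum>x\<in>UNIV. \<alpha> $ x)"

definition to_prob :: "real ^ 'a::finite \<Rightarrow> real ^ 'a" where
  "to_prob \<alpha> = \<alpha> /\<^sub>R mass \<alpha>"

lemma upd_nth [simp]: "upd \<alpha> y b $ i = (if i = y then b else \<alpha> $ i)"
  by (simp add: upd_def)

lemma upd_upd_same [simp]: "upd (upd \<alpha> y a) y b = upd \<alpha> y b"
  by (simp add: vec_eq_iff)

lemma upd_id [simp]: "upd \<alpha> y (\<alpha> $ y) = \<alpha>"
  by (simp add: vec_eq_iff)

lemma upd_commute: "x \<noteq> y \<Longrightarrow> upd (upd \<alpha> x a) y b = upd (upd \<alpha> y b) x a"
  by (simp add: vec_eq_iff)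

lemma upd_eq_axis: "upd \<alpha> y b = \<alpha> + (b - \<alpha> $ y) *\<^sub>R axis y 1"
  by (simp add: vec_eq_iff axis_def)

lemma upd_pos [intro]: "\<alpha> \<in> pos_vecs \<Longrightarrow> b > 0 \<Longrightarrow> upd \<alpha> y b \<in> pos_vecs"
  by (simp add: pos_vecs_def)

lemma scale_pos [intro]: "\<alpha> \<in> pos_vecs \<Longrightarrow> c > 0 \<Longrightarrow> c *\<^sub>R \<alpha> \<in> pos_vecs"
  by (simp add: pos_vecs_def)

lemma mass_pos: "\<alpha> \<in> pos_vecs \<Longrightarrow> mass \<alpha> > 0"
  unfolding mass_def pos_vecs_def by (rule sum_pos) auto

lemma mass_add: "mass (\<alpha> + \<beta>) = mass \<alpha> + mass \<beta>"
  by (simp add: mass_def sum.distrib)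

lemma mass_diff: "mass (\<alpha> - \<beta>) = mass \<alpha> - mass \<beta>"
  by (simp add: mass_def sum_subtractf)

lemma mass_scale: "mass (c *\<^sub>R \<alpha>) = c * mass \<alpha>"
  by (simp add: mass_def sum_distrib_left)

lemma mass_axis: "mass (axis y c) = c"
  by (simp add: mass_def axis_def)

lemma mass_upd: "mass (upd \<alpha> y b) = mass \<alpha> + (b - \<alpha> $ y)"
  by (simp add: upd_eq_axis mass_add mass_scale mass_axis)

lemma pos_probs_iff: "p \<in> pos_probs \<longleftrightarrow> p \<in> pos_vecs \<and> mass p = 1"
  by (simp add: pos_probs_def mass_def)

lemma to_prob_in: "\<alpha> \<in> pos_vecs \<Longrightarrow> to_prob \<alpha> \<in> pos_probs"
  using mass_pos[of \<alpha>] by (simp add: to_prob_def pos_probs_iff mass_scale scale_pos)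

lemma to_prob_id: "p \<in> pos_probs \<Longrightarrow> to_prob p = p"
  by (simp add: to_prob_def pos_probs_iff)

lemma to_prob_scale: "c > 0 \<Longrightarrow> to_prob (c *\<^sub>R \<alpha>) = to_prob \<alpha>"
  by (simp add: to_prob_def mass_scale)

lemma hom_ext_eq: "hom_ext S x \<alpha> = S x (to_prob \<alpha>)"
  by (simp add: hom_ext_def to_prob_def mass_def)

lemma entropy_scale: "c > 0 \<Longrightarrow> entropy S (c *\<^sub>R \<alpha>) = c * entropy S \<alpha>"
  by (simp add: entropy_def hom_ext_eq to_prob_scale sum_distrib_left mult.assoc)

lemma continuous_on_mass [continuous_intros]: "continuous_on A mass"
  unfolding mass_def[abs_def] by (intro continuous_intros)

lemma continuous_on_to_prob: "continuous_on pos_vecs to_prob"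
proof -
  have "\<forall>\<alpha>\<in>pos_vecs. mass \<alpha> \<noteq> (0::real)" using mass_pos by fastforce
  then show ?thesis
    unfolding to_prob_def[abs_def] by (intro continuous_intros) auto
qed

lemma to_prob_upd_deriv:
  assumes "\<alpha> \<in> pos_vecs"
  shows "((\<lambda>t. to_prob (upd \<alpha> y t)) has_vector_derivative
           (axis y 1 - to_prob \<alpha>) /\<^sub>R mass \<alpha>) (at (\<alpha> $ y))"
proof -
  have t: "mass \<alpha> \<noteq> 0" using mass_pos[OF assms] by simp
  have "((\<lambda>t. inverse (mass \<alpha> + (t - \<alpha> $ y)) *\<^sub>R (\<alpha> + (t - \<alpha> $ y) *\<^sub>R axis y 1))
      has_vector_derivative
      inverse (mass \<alpha> + (\<alpha> $ y - \<alpha> $ y)) *\<^sub>R axis y 1 +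
      (- (inverse (mass \<alpha>) * inverse (mass \<alpha>))) *\<^sub>R (\<alpha> + (\<alpha> $ y - \<alpha> $ y) *\<^sub>R axis y 1)) (at (\<alpha> $ y))"
    apply (rule has_vector_derivative_scaleR)
    subgoal using t by (auto intro!: derivative_eq_intros simp: power2_eq_square)
    subgoal by (auto intro!: derivative_eq_intros)
    done
  then show ?thesis
    by (simp add: to_prob_def mass_upd[unfolded upd_eq_axis] upd_eq_axis scaleR_diff_right)
qed


section \<open>Second differences and second partial derivatives\<close>

text \<open>
  The mixed second difference of \<open>f\<close> in the two coordinates vanishes, whatever the
  values of the other coordinates.
\<close>

definition additive_in :: "(real ^ 'a::finite \<Rightarrow> real) \<Rightarrow> 'a \<Rightarrow> 'a \<Rightarrow> bool" where
  "additive_in f y z \<longleftrightarrow> (\<forall>\<alpha>\<in>pos_vecs. \<forall>a>0. \<forall>b>0.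
     f (upd (upd \<alpha> y a) z b) = f (upd \<alpha> y a) + f (upd \<alpha> z b) - f \<alpha>)"

lemma const_of_zero_deriv_pos:
  fixes \<phi> :: "real \<Rightarrow> real"
  assumes "\<And>t. t > 0 \<Longrightarrow> (\<phi> has_real_derivative 0) (at t)" "a > 0" "b > 0"
  shows "\<phi> a = \<phi> b"
  by (rule DERIV_isconst3[of 0 "max a b + 1"]) (use assms in auto)

text \<open>
  The mean value theorem in direction \<open>x\<close>, applied to the first difference in direction \<open>y\<close>, and then in
  direction \<open>y\<close>, applied to the partial derivative in direction \<open>x\<close>.
\<close>

lemma second_difference_mean_value:
  fixes f g k :: "real ^ 'a::finite \<Rightarrow> real"
  assumes \<alpha>: "\<alpha> \<in> pos_vecs" and h: "h > 0"
    and f: "\<And>\<beta>. \<beta> \<in> pos_vecs \<Longrightarrow> ((\<lambda>t. f (upd \<beta> x t)) has_real_derivative g \<beta>) (at (\<beta> $ x))"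
    and g: "\<And>\<beta>. \<beta> \<in> pos_vecs \<Longrightarrow> ((\<lambda>t. g (upd \<beta> y t)) has_real_derivative k \<beta>) (at (\<beta> $ y))"
    and xy: "x \<noteq> y"
  shows "\<exists>u v. \<alpha> $ x < u \<and> u < \<alpha> $ x + h \<and> \<alpha> $ y < v \<and> v < \<alpha> $ y + h \<and>
    f (upd (upd \<alpha> x (\<alpha> $ x + h)) y (\<alpha> $ y + h)) - f (upd \<alpha> x (\<alpha> $ x + h))
      - f (upd \<alpha> y (\<alpha> $ y + h)) + f \<alpha> = h * h * k (upd (upd \<alpha> x u) y v)"
proof -
  have ax: "\<alpha> $ x > 0" and ay: "\<alpha> $ y > 0" using \<alpha> by (auto simp: pos_vecs_def)
  have f': "((\<lambda>t. f (upd \<beta> x t)) has_real_derivative g (upd \<beta> x t)) (at t)"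
    if "\<beta> \<in> pos_vecs" "t > 0" for \<beta> t
    using f[OF upd_pos[OF that, of x]] by simp
  have g': "((\<lambda>t. g (upd \<beta> y t)) has_real_derivative k (upd \<beta> y t)) (at t)"
    if "\<beta> \<in> pos_vecs" "t > 0" for \<beta> t
    using g[OF upd_pos[OF that, of y]] by simp
  let ?\<beta> = "upd \<alpha> y (\<alpha> $ y + h)"
  have \<beta>: "?\<beta> \<in> pos_vecs" using \<alpha> ay h by (intro upd_pos) auto
  have "((\<lambda>t. f (upd ?\<beta> x t) - f (upd \<alpha> x t)) has_real_derivative
      g (upd ?\<beta> x t) - g (upd \<alpha> x t)) (at t)" if "t > 0" for t
    using that \<alpha> \<beta> by (intro DERIV_diff f') auto
  then obtain u where u: "\<alpha> $ x < u" "u < \<alpha> $ x + h"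
    "(f (upd ?\<beta> x (\<alpha> $ x + h)) - f (upd \<alpha> x (\<alpha> $ x + h))) - (f (upd ?\<beta> x (\<alpha> $ x)) - f (upd \<alpha> x (\<alpha> $ x)))
       = (\<alpha> $ x + h - \<alpha> $ x) * (g (upd ?\<beta> x u) - g (upd \<alpha> x u))"
    using MVT2[of "\<alpha> $ x" "\<alpha> $ x + h" "\<lambda>t. f (upd ?\<beta> x t) - f (upd \<alpha> x t)"
        "\<lambda>t. g (upd ?\<beta> x t) - g (upd \<alpha> x t)"] h ax by force
  have \<gamma>: "upd \<alpha> x u \<in> pos_vecs" using \<alpha> ax u by (intro upd_pos) auto
  obtain v where v: "\<alpha> $ y < v" "v < \<alpha> $ y + h"
    "g (upd (upd \<alpha> x u) y (\<alpha> $ y + h)) - g (upd (upd \<alpha> x u) y (\<alpha> $ y))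
       = (\<alpha> $ y + h - \<alpha> $ y) * k (upd (upd \<alpha> x u) y v)"
    using MVT2[of "\<alpha> $ y" "\<alpha> $ y + h" "\<lambda>t. g (upd (upd \<alpha> x u) y t)"
        "\<lambda>t. k (upd (upd \<alpha> x u) y t)"] g'[OF \<gamma>] h ay by force
  have 1: "upd ?\<beta> x c = upd (upd \<alpha> x c) y (\<alpha> $ y + h)" for c
    using xy by (simp add: upd_commute)
  have 2: "upd ?\<beta> x (\<alpha> $ x) = ?\<beta>" and 3: "upd (upd \<alpha> x u) y (\<alpha> $ y) = upd \<alpha> x u"
    using xy by (simp_all add: vec_eq_iff)
  have "f (upd (upd \<alpha> x (\<alpha> $ x + h)) y (\<alpha> $ y + h)) - f (upd \<alpha> x (\<alpha> $ x + h))
      - f ?\<beta> + f \<alpha> = h * (g (upd ?\<beta> x u) - g (upd \<alpha> x u))"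
    using u(3) unfolding 2 by (simp add: 1[of "\<alpha> $ x + h"])
  also have "\<dots> = h * h * k (upd (upd \<alpha> x u) y v)"
    using v(3) unfolding 1 3 by simp
  finally show ?thesis using u v by blast
qed

text \<open>
  Schwarz's theorem on the positive orthant: the second difference over a square of side \<open>h\<close> is \<open>h\<^sup>2\<close> times
  a value of \<open>k\<close> and also \<open>h\<^sup>2\<close> times a value of \<open>k'\<close>, both taken in the square, which shrinks to \<open>\<alpha>\<close>.
\<close>

lemma symmetric_second_partials:
  fixes f g g' k k' :: "real ^ 'a::finite \<Rightarrow> real"
  assumes \<alpha>: "\<alpha> \<in> pos_vecs" and xy: "x \<noteq> y"
    and f: "\<And>\<beta>. \<beta> \<in> pos_vecs \<Longrightarrow> ((\<lambda>t. f (upd \<beta> x t)) has_real_derivative g \<beta>) (at (\<beta> $ x))"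
    and g: "\<And>\<beta>. \<beta> \<in> pos_vecs \<Longrightarrow> ((\<lambda>t. g (upd \<beta> y t)) has_real_derivative k \<beta>) (at (\<beta> $ y))"
    and f': "\<And>\<beta>. \<beta> \<in> pos_vecs \<Longrightarrow> ((\<lambda>t. f (upd \<beta> y t)) has_real_derivative g' \<beta>) (at (\<beta> $ y))"
    and g': "\<And>\<beta>. \<beta> \<in> pos_vecs \<Longrightarrow> ((\<lambda>t. g' (upd \<beta> x t)) has_real_derivative k' \<beta>) (at (\<beta> $ x))"
    and k: "continuous_on pos_vecs k" "continuous_on pos_vecs k'"
  shows "k \<alpha> = k' \<alpha>"
proof -
  define h :: "nat \<Rightarrow> real" where "h n = 1 / real (Suc n)" for n
  have h0: "h n > 0" for n by (simp add: h_def)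
  have h: "h \<longlonglongrightarrow> 0" unfolding h_def by (rule LIMSEQ_Suc[OF lim_1_over_n])
  have squeeze: "(\<lambda>n. u n) \<longlonglongrightarrow> c" if "\<And>n. c < u n \<and> u n < c + h n" for c and u :: "nat \<Rightarrow> real"
  proof (rule tendsto_sandwich[of "\<lambda>_. c" u sequentially "\<lambda>n. c + h n" c])
    show "(\<lambda>n. c + h n) \<longlonglongrightarrow> c" using tendsto_add[OF tendsto_const h, of c] by simp
  qed (use that in \<open>auto simp: less_imp_le\<close>)
  have conv: "(\<lambda>n. q (upd (upd \<alpha> x (u n)) y (v n))) \<longlonglongrightarrow> q \<alpha>"
    if u: "\<And>n. \<alpha> $ x < u n \<and> u n < \<alpha> $ x + h n" and v: "\<And>n. \<alpha> $ y < v n \<and> v n < \<alpha> $ y + h n"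
      and q: "continuous_on pos_vecs q" for u v and q :: "real ^ 'a \<Rightarrow> real"
  proof -
    have "(\<lambda>n. upd (upd \<alpha> x (u n)) y (v n)) \<longlonglongrightarrow> \<alpha>"
    proof (rule vec_tendstoI)
      fix i
      show "(\<lambda>n. upd (upd \<alpha> x (u n)) y (v n) $ i) \<longlonglongrightarrow> \<alpha> $ i"
        using squeeze[OF u] squeeze[OF v] by (cases "i = y"; cases "i = x") simp_all
    qed
    moreover have "upd (upd \<alpha> x (u n)) y (v n) \<in> pos_vecs" for n
      using \<alpha> u[of n] v[of n] less_trans by (intro upd_pos) (auto simp: pos_vecs_def)
    ultimately show ?thesis
      using q \<alpha> by (intro continuous_on_tendsto_compose[OF q]) auto
  qed
  obtain u v where uv: "\<And>n. \<alpha> $ x < u n \<and> u n < \<alpha> $ x + h n" "\<And>n. \<alpha> $ y < v n \<and> v n < \<alpha> $ y + h n"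
    and 1: "\<And>n. f (upd (upd \<alpha> x (\<alpha> $ x + h n)) y (\<alpha> $ y + h n)) - f (upd \<alpha> x (\<alpha> $ x + h n))
      - f (upd \<alpha> y (\<alpha> $ y + h n)) + f \<alpha> = h n * h n * k (upd (upd \<alpha> x (u n)) y (v n))"
    using second_difference_mean_value[OF \<alpha> h0 f g xy] by metis
  obtain u' v' where uv': "\<And>n. \<alpha> $ x < u' n \<and> u' n < \<alpha> $ x + h n" "\<And>n. \<alpha> $ y < v' n \<and> v' n < \<alpha> $ y + h n"
    and 2: "\<And>n. f (upd (upd \<alpha> y (\<alpha> $ y + h n)) x (\<alpha> $ x + h n)) - f (upd \<alpha> y (\<alpha> $ y + h n))
      - f (upd \<alpha> x (\<alpha> $ x + h n)) + f \<alpha> = h n * h n * k' (upd (upd \<alpha> y (v' n)) x (u' n))"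
    using second_difference_mean_value[OF \<alpha> h0 f' g' xy[symmetric]] by metis
  have eq: "h n * h n * k (upd (upd \<alpha> x (u n)) y (v n)) = h n * h n * k' (upd (upd \<alpha> x (u' n)) y (v' n))" for n
    using 1[of n] 2[of n] unfolding upd_commute[OF xy] by linarith
  have "k (upd (upd \<alpha> x (u n)) y (v n)) = k' (upd (upd \<alpha> x (u' n)) y (v' n))" for n
    using eq[of n] h0[of n] by auto
  then show ?thesis
    using conv[OF uv k(1)] conv[OF uv' k(2)] by (auto intro: LIMSEQ_unique)
qed


section \<open>Scores as the gradient of the entropy\<close>

locale smooth_proper_score =
  fixes S :: "'a::finite \<Rightarrow> real ^ 'a \<Rightarrow> real"
    and D :: "'a \<Rightarrow> real ^ 'a \<Rightarrow> (real ^ 'a) \<Rightarrow>\<^sub>L real"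
  assumes proper: "proper_score S"
    and D_cont: "\<And>x. continuous_on pos_probs (D x)"
    and S_deriv: "\<And>x p. p \<in> pos_probs \<Longrightarrow>
                    (S x has_derivative blinfun_apply (D x p)) (at p within pos_probs)"
begin

text \<open>
  The partial derivative of \<open>hom_ext S x\<close> in direction \<open>y\<close> (see \<open>hom_ext_partial\<close>). The argument of the
  derivative \<open>D x\<close> is the velocity of the normalised vector; it has coordinate sum \<open>0\<close>,
  so the value does not depend on the choice of \<open>D\<close>.
\<close>

definition score_partial :: "'a \<Rightarrow> 'a \<Rightarrow> real ^ 'a \<Rightarrow> real" where
  "score_partial x y \<alpha> = blinfun_apply (D x (to_prob \<alpha>)) (axis y 1 - to_prob \<alpha>) / mass \<alpha>"

text \<open>
  The derivative of \<open>S x\<close> is only given within the simplex, so the chain rule is used along curves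
  that stay in the simplex.
\<close>

lemma score_along_curve:
  assumes "open T" "t0 \<in> T" "\<And>t. t \<in> T \<Longrightarrow> c t \<in> pos_probs"
    and "(c has_vector_derivative v) (at t0)"
  shows "((\<lambda>t. S x (c t)) has_real_derivative blinfun_apply (D x (c t0)) v) (at t0)"
proof -
  have "(c has_derivative (\<lambda>h. h *\<^sub>R v)) (at t0 within T)"
    using assms(4) has_derivative_at_withinI by (auto simp: has_vector_derivative_def)
  then have "((\<lambda>t. S x (c t)) has_derivative (\<lambda>h. D x (c t0) (h *\<^sub>R v))) (at t0 within T)"
    by (intro has_derivative_in_compose2[of pos_probs "S x" "\<lambda>p. blinfun_apply (D x p)" c T t0] S_deriv)
      (use assms(2,3) in auto)
  moreover have "(\<lambda>h. D x (c t0) (h *\<^sub>R v)) = (*) (D x (c t0) v)"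
    by (simp add: blinfun.scaleR_right fun_eq_iff)
  ultimately show ?thesis
    using at_within_open[OF assms(2,1)] by (simp only: has_field_derivative_def)
qed

lemma hom_ext_partial:
  assumes "\<alpha> \<in> pos_vecs"
  shows "((\<lambda>t. hom_ext S x (upd \<alpha> y t)) has_real_derivative score_partial x y \<alpha>) (at (\<alpha> $ y))"
proof -
  have "((\<lambda>t. S x (to_prob (upd \<alpha> y t))) has_real_derivative
      blinfun_apply (D x (to_prob (upd \<alpha> y (\<alpha> $ y)))) ((axis y 1 - to_prob \<alpha>) /\<^sub>R mass \<alpha>)) (at (\<alpha> $ y))"
    by (rule score_along_curve[where T = "{0<..}"])
      (use assms in \<open>auto simp: pos_vecs_def intro!: to_prob_in to_prob_upd_deriv\<close>)
  then show ?thesis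
    by (simp add: hom_ext_eq score_partial_def blinfun.scaleR_right divide_inverse mult.commute)
qed

lemma hom_ext_partial_upd:
  assumes "\<alpha> \<in> pos_vecs" "t > 0"
  shows "((\<lambda>t. hom_ext S x (upd \<alpha> y t)) has_real_derivative score_partial x y (upd \<alpha> y t)) (at t)"
  using hom_ext_partial[OF upd_pos[OF assms, of y], of x y] by simp

lemma score_partial_continuous: "continuous_on pos_vecs (score_partial x y)"
proof -
  have "\<forall>\<alpha>\<in>pos_vecs. mass \<alpha> \<noteq> (0::real)" using mass_pos by fastforce
  moreover have "continuous_on pos_vecs (\<lambda>\<alpha>. D x (to_prob \<alpha>))"
    using continuous_on_compose2[OF D_cont continuous_on_to_prob] to_prob_in by blast
  ultimately show ?thesis
    unfolding score_partial_def[abs_def]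
    by (intro continuous_intros continuous_on_to_prob) auto
qed

lemma score_partial_to_prob: "\<alpha> \<in> pos_vecs \<Longrightarrow> score_partial x y \<alpha> = score_partial x y (to_prob \<alpha>) / mass \<alpha>"
  using to_prob_in[of \<alpha>] by (simp add: score_partial_def to_prob_id pos_probs_iff)

text \<open>
  Propriety carried over to unnormalised vectors: the scores at \<open>\<beta>\<close> form a supergradient of the entropy.
\<close>

lemma entropy_le:
  assumes "\<alpha> \<in> pos_vecs" "\<beta> \<in> pos_vecs"
  shows "entropy S \<alpha> \<le> (\<Sum>x\<in>UNIV. \<alpha> $ x * hom_ext S x \<beta>)"
proof -
  have "expected_score S (to_prob \<alpha>) (to_prob \<alpha>) \<le> expected_score S (to_prob \<alpha>) (to_prob \<beta>)"
    using proper to_prob_in assms unfolding proper_score_def by blast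
  moreover have "mass \<alpha> * expected_score S (to_prob \<alpha>) q = (\<Sum>x\<in>UNIV. \<alpha> $ x * S x q)" for q
    using mass_pos[OF assms(1)] unfolding expected_score_def to_prob_def sum_distrib_left
    by (simp add: field_simps)
  ultimately show ?thesis
    using mult_left_mono[of "expected_score S (to_prob \<alpha>) (to_prob \<alpha>)"
        "expected_score S (to_prob \<alpha>) (to_prob \<beta>)" "mass \<alpha>"] mass_pos[OF assms(1)]
    by (simp add: entropy_def hom_ext_eq)
qed

text \<open>
  The first-order condition for the minimum of the expected score in \<open>entropy_le\<close>.
\<close>

lemma stationary:
  assumes "\<alpha> \<in> pos_vecs"
  shows "(\<Sum>x\<in>UNIV. \<alpha> $ x * score_partial x y \<alpha>) = 0"
proof -
  let ?f = "\<lambda>t. \<Sum>x\<in>UNIV. \<alpha> $ x * hom_ext S x (upd \<alpha> y t)"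
  have d: "(?f has_real_derivative (\<Sum>x\<in>UNIV. \<alpha> $ x * score_partial x y \<alpha>)) (at (\<alpha> $ y))"
    by (intro DERIV_sum DERIV_cmult hom_ext_partial assms)
  have y: "\<alpha> $ y > 0" using assms by (simp add: pos_vecs_def)
  have "?f (\<alpha> $ y) \<le> ?f t" if "\<bar>\<alpha> $ y - t\<bar> < \<alpha> $ y" for t
    using entropy_le[OF assms upd_pos[OF assms, of t y]] that by (simp add: entropy_def)
  then show ?thesis
    using DERIV_local_min[OF d y] by blast
qed

text \<open>
  In the product rule for \<open>\<Sum>\<^sub>x \<alpha>\<^sub>x S x \<alpha>\<close> the terms with derivatives of scores cancel by \<open>stationary\<close>.
\<close>

lemma entropy_partial:
  assumes "\<alpha> \<in> pos_vecs"
  shows "((\<lambda>t. entropy S (upd \<alpha> y t)) has_real_derivative hom_ext S y \<alpha>) (at (\<alpha> $ y))"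
proof -
  have "((\<lambda>t. upd \<alpha> y t $ x * hom_ext S x (upd \<alpha> y t)) has_real_derivative
      (if x = y then 1 else 0) * hom_ext S x (upd \<alpha> y (\<alpha> $ y)) + score_partial x y \<alpha> * upd \<alpha> y (\<alpha> $ y) $ x) (at (\<alpha> $ y))" for x
    by (rule DERIV_mult[OF _ hom_ext_partial[OF assms]]) (auto intro!: derivative_eq_intros)
  then have "((\<lambda>t. entropy S (upd \<alpha> y t)) has_real_derivative
      (\<Sum>x\<in>UNIV. (if x = y then 1 else 0) * hom_ext S x \<alpha> + score_partial x y \<alpha> * \<alpha> $ x)) (at (\<alpha> $ y))"
    unfolding entropy_def by (intro DERIV_sum) simp
  moreover have "(\<Sum>x\<in>UNIV. (if x = y then 1 else 0) * hom_ext S x \<alpha>) = hom_ext S y \<alpha>"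
    by (subst sum.mono_neutral_right[of UNIV "{y}"]) auto
  moreover have "(\<Sum>x\<in>UNIV. score_partial x y \<alpha> * \<alpha> $ x) = 0"
    using stationary[OF assms, of y] by (simp only: mult.commute)
  ultimately show ?thesis
    by (simp only: sum.distrib add_0_right)
qed

lemma entropy_partial_upd:
  assumes "\<alpha> \<in> pos_vecs" "t > 0"
  shows "((\<lambda>t. entropy S (upd \<alpha> y t)) has_real_derivative hom_ext S y (upd \<alpha> y t)) (at t)"
  using entropy_partial[OF upd_pos[OF assms, of y], of y] by simp

text \<open>
  Both sides are mixed second partial derivatives of the entropy.
\<close>

lemma score_partial_symmetric: "\<alpha> \<in> pos_vecs \<Longrightarrow> x \<noteq> y \<Longrightarrow> score_partial x y \<alpha> = score_partial y x \<alpha>"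
  by (rule symmetric_second_partials[where f = "entropy S"])
    (auto intro: entropy_partial hom_ext_partial score_partial_continuous)

section \<open>Scores are insensitive to coordinates outside the neighbourhood\<close>

text \<open>
  To vary \<open>p $ y\<close> within the simplex, some other coordinate has to compensate. If it is a
  coordinate \<open>z\<close> outside the neighbourhood of \<open>x\<close>, the local representation does not notice,
  so the local partial derivative is the derivative of the score in the direction \<open>axis y 1 - axis z 1\<close>.
\<close>

lemma local_partial_eq:
  assumes "local_repr E S s" and p: "p \<in> pos_probs" and z: "z \<notin> nbhd E x"
  shows "local_partial E s x y p = score_partial x y p - score_partial x z p"
proof (cases "y = z")
  case True
  then show ?thesis using z by (simp add: local_partial_def)
next
  case False
  define c where "c t = p + (t - p $ y) *\<^sub>R (axis y 1 - axis z 1)" for t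
  define T where "T = {0<..<p $ y + p $ z}"
  have pos: "p $ i > 0" for i using p by (simp add: pos_probs_iff pos_vecs_def)
  have c_nth: "c t $ i = (if i = y then t else if i = z then p $ y + p $ z - t else p $ i)" for t i
    using False by (simp add: c_def axis_def)
  have c_in: "c t \<in> pos_probs" if "t \<in> T" for t
  proof -
    have "c t \<in> pos_vecs" using that pos by (simp add: pos_vecs_def c_nth T_def)
    moreover have "mass (c t) = 1"
      using p by (simp add: c_def mass_add mass_scale mass_diff mass_axis pos_probs_iff)
    ultimately show ?thesis by (simp add: pos_probs_iff)
  qed
  have T: "open T" "p $ y \<in> T" using pos by (auto simp: T_def)
  have "c (p $ y) = p" by (simp add: c_def)
  moreover have "(c has_vector_derivative axis y 1 - axis z 1) (at (p $ y))"
    unfolding c_def by (auto intro!: derivative_eq_intros)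
  ultimately have "((\<lambda>t. S x (c t)) has_real_derivative blinfun_apply (D x p) (axis y 1 - axis z 1)) (at (p $ y))"
    using score_along_curve[where c = c and v = "axis y 1 - axis z 1" and x = x, OF T c_in] by simp
  moreover have "blinfun_apply (D x p) (axis y 1 - axis z 1) = score_partial x y p - score_partial x z p"
    using p by (simp add: score_partial_def to_prob_id pos_probs_iff blinfun.diff_right)
  ultimately have d: "((\<lambda>t. S x (c t)) has_real_derivative score_partial x y p - score_partial x z p) (at (p $ y))" by simp
  have sub: "subvec (c t) (nbhd E x) =
      (if y \<in> nbhd E x then (subvec p (nbhd E x))(y := t) else subvec p (nbhd E x))" for t
    using z by (auto simp: subvec_def c_nth fun_eq_iff)
  have "((\<lambda>t. s x (subvec (c t) (nbhd E x))) has_real_derivative score_partial x y p - score_partial x z p) (at (p $ y))"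
    using assms(1) c_in by (intro DERIV_cong_ev[THEN iffD1, OF refl _ refl d] eventually_mono[OF eventually_nhds_in_open[OF T]])
      (auto simp: local_repr_def)
  then show ?thesis
    using DERIV_unique[OF DERIV_const[of "s x (subvec p (nbhd E x))"], of "score_partial x y p - score_partial x z p" "p $ y"]
    by (cases "y \<in> nbhd E x") (simp_all add: local_partial_def sub DERIV_imp_deriv)
qed

text \<open>
  In the notation of the introduction, \<open>const\<close> says that \<open>T\<^sub>x\<close> is well defined, \<open>all\<close> that it does not depend
  on \<open>x\<close>, and the final computation evaluates the key equation. It suffices to argue at the normalised
  vector \<open>p\<close>, because the partial derivatives are homogeneous of degree \<open>-1\<close>.
\<close>

lemma score_partial_nonadjacent:
  assumes E: "symp E" "disjointness_condition E"
    and s: "local_repr E S s"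
    and key: "\<And>p y. p \<in> pos_probs \<Longrightarrow> (\<Sum>x\<in>UNIV. p $ x * local_partial E s x y p) = 0"
    and \<alpha>: "\<alpha> \<in> pos_vecs" and z: "z \<notin> nbhd E x"
  shows "score_partial x z \<alpha> = 0"
proof -
  define p where "p = to_prob \<alpha>"
  have p: "p \<in> pos_probs" "p \<in> pos_vecs" using to_prob_in[OF \<alpha>] by (auto simp: p_def pos_probs_iff)
  have nbhd_sym: "y \<in> nbhd E x \<longleftrightarrow> x \<in> nbhd E y" for x y
    using E(1) by (auto simp: nbhd_def dest: sympD)
  obtain y1 y2 where disj: "rho E y1 \<inter> rho E y2 = {}"
    using E(2) by (auto simp: disjointness_condition_def)
  have far: "y1 \<notin> nbhd E x \<or> y2 \<notin> nbhd E x" for x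
  proof (rule ccontr)
    assume "\<not> ?thesis"
    then have "y1 \<in> rho E y1" "y1 \<in> rho E y2"
      by (auto simp: rho_def related_def)
    with disj show False by blast
  qed
  have const: "score_partial x y p = score_partial x z p" if "y \<notin> nbhd E x" "z \<notin> nbhd E x" for x y z
    using local_partial_eq[OF s p(1) that(2), of y] that(1) by (simp add: local_partial_def)
  have sym: "score_partial x y p = score_partial y x p" if "y \<notin> nbhd E x" for x y
    using score_partial_symmetric[OF p(2)] that by (metis Un_iff insertI1 nbhd_def)
  have y12: "y2 \<notin> nbhd E y1" using far[of y1] by (simp add: nbhd_def)
  have all: "score_partial x z p = score_partial y1 y2 p" if "z \<notin> nbhd E x" for x z
  proof (cases "y1 \<in> nbhd E x")
    case False
    then have "score_partial x z p = score_partial y1 x p" using const[OF that False] sym[OF False] by simp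
    also have "\<dots> = score_partial y1 y2 p" using False y12 nbhd_sym const by blast
    finally show ?thesis .
  next
    case True
    then have 2: "y2 \<notin> nbhd E x" using far by blast
    then have "score_partial x z p = score_partial y2 x p" using const[OF that 2] sym[OF 2] by simp
    also have "\<dots> = score_partial y2 y1 p" using 2 y12 nbhd_sym const by blast
    finally show ?thesis using sym[OF y12] by simp
  qed
  define w where "w x = (if y1 \<in> nbhd E x then y2 else y1)" for x
  have w: "w x \<notin> nbhd E x" for x using far[of x] by (simp add: w_def)
  have "0 = (\<Sum>x\<in>UNIV. p $ x * (score_partial x y1 p - score_partial y1 y2 p))"
    using key[OF p(1), of y1] local_partial_eq[OF s p(1) w] all[OF w] by simp
  also have "\<dots> = (\<Sum>x\<in>UNIV. p $ x * score_partial x y1 p) - mass p * score_partial y1 y2 p"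
    by (simp add: mass_def right_diff_distrib sum_subtractf sum_distrib_right)
  also have "\<dots> = - score_partial y1 y2 p"
    using stationary[OF p(2)] p(1) by (simp add: pos_probs_iff)
  finally have "score_partial x z p = 0" using all[OF z] by simp
  then show ?thesis using score_partial_to_prob[OF \<alpha>, of x z] by (simp add: p_def)
qed

lemma hom_ext_upd:
  assumes zero: "\<And>\<beta>. \<beta> \<in> pos_vecs \<Longrightarrow> score_partial x y \<beta> = 0" and "\<alpha> \<in> pos_vecs" "b > 0"
  shows "hom_ext S x (upd \<alpha> y b) = hom_ext S x \<alpha>"
proof -
  have "hom_ext S x (upd \<alpha> y b) = hom_ext S x (upd \<alpha> y (\<alpha> $ y))"
  proof (rule const_of_zero_deriv_pos[where \<phi> = "\<lambda>t. hom_ext S x (upd \<alpha> y t)"])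
    fix t :: real assume "t > 0"
    then show "((\<lambda>t. hom_ext S x (upd \<alpha> y t)) has_real_derivative 0) (at t)"
      using hom_ext_partial_upd[OF assms(2), of t x y] zero[OF upd_pos[OF assms(2)]] by simp
  qed (use assms in \<open>auto simp: pos_vecs_def\<close>)
  then show ?thesis by simp
qed

text \<open>
  The difference of the entropies before and after an update of coordinate \<open>y\<close> is constant in coordinate \<open>x\<close>,
  since its derivative is a difference of scores at \<open>x\<close>.
\<close>

lemma entropy_additive_in:
  assumes zero: "\<And>\<beta>. \<beta> \<in> pos_vecs \<Longrightarrow> score_partial x y \<beta> = 0" and "x \<noteq> y"
  shows "additive_in (entropy S) x y"
  unfolding additive_in_def
proof (intro ballI allI impI)
  fix \<alpha> :: "real ^ 'a" and a b :: real
  assume \<alpha>: "\<alpha> \<in> pos_vecs" and a: "a > 0" and b: "b > 0"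
  let ?\<phi> = "\<lambda>t. entropy S (upd (upd \<alpha> y b) x t) - entropy S (upd \<alpha> x t)"
  have "?\<phi> a = ?\<phi> (\<alpha> $ x)"
  proof (rule const_of_zero_deriv_pos[where \<phi> = ?\<phi>])
    fix t :: real assume t: "t > 0"
    have "(?\<phi> has_real_derivative hom_ext S x (upd (upd \<alpha> y b) x t) - hom_ext S x (upd \<alpha> x t)) (at t)"
      using \<alpha> b t by (intro DERIV_diff entropy_partial_upd) auto
    moreover have "hom_ext S x (upd (upd \<alpha> y b) x t) = hom_ext S x (upd \<alpha> x t)"
      using hom_ext_upd[OF zero upd_pos[OF \<alpha> t, of x] b] assms(2) by (simp add: upd_commute[of x y])
    ultimately show "(?\<phi> has_real_derivative 0) (at t)" by simp
  qed (use \<alpha> a in \<open>auto simp: pos_vecs_def\<close>)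
  moreover have "upd (upd \<alpha> y b) x (\<alpha> $ x) = upd \<alpha> y b"
    using assms(2) by (simp add: vec_eq_iff)
  ultimately show "entropy S (upd (upd \<alpha> x a) y b) = entropy S (upd \<alpha> x a) + entropy S (upd \<alpha> y b) - entropy S \<alpha>"
    using assms(2) by (simp add: upd_commute[of x y])
qed

text \<open>
  If \<open>x\<close> differs from \<open>y\<close> and \<open>z\<close>, differentiate the identity for the entropy in direction \<open>x\<close>; otherwise
  the score at \<open>x\<close> does not depend on one of the two coordinates at all.
\<close>

lemma hom_ext_additive_in:
  assumes zero: "\<And>\<beta>. \<beta> \<in> pos_vecs \<Longrightarrow> score_partial y z \<beta> = 0" "\<And>\<beta>. \<beta> \<in> pos_vecs \<Longrightarrow> score_partial z y \<beta> = 0" and yz: "y \<noteq> z"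
  shows "additive_in (hom_ext S x) y z"
  unfolding additive_in_def
proof (intro ballI allI impI)
  fix \<alpha> :: "real ^ 'a" and a b :: real
  assume \<alpha>: "\<alpha> \<in> pos_vecs" and a: "a > 0" and b: "b > 0"
  consider "x = y" | "x = z" | "x \<noteq> y" "x \<noteq> z" by blast
  then show "hom_ext S x (upd (upd \<alpha> y a) z b) = hom_ext S x (upd \<alpha> y a) + hom_ext S x (upd \<alpha> z b) - hom_ext S x \<alpha>"
  proof cases
    case 1
    then show ?thesis
      using hom_ext_upd[OF zero(1) \<alpha> b] hom_ext_upd[OF zero(1) upd_pos[OF \<alpha> a, of y] b] by simp
  next
    case 2
    then show ?thesis
      using hom_ext_upd[OF zero(2) \<alpha> a] hom_ext_upd[OF zero(2) upd_pos[OF \<alpha> b, of z] a]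
      by (simp add: upd_commute[OF yz])
  next
    case 3
    let ?\<phi> = "\<lambda>t. entropy S (upd (upd (upd \<alpha> y a) z b) x t) - entropy S (upd (upd \<alpha> y a) x t)
      - entropy S (upd (upd \<alpha> z b) x t) + entropy S (upd \<alpha> x t)"
    have x: "\<alpha> $ x > 0" using \<alpha> by (simp add: pos_vecs_def)
    have "?\<phi> t = 0" if "t > 0" for t
    proof -
      have "upd \<alpha> x t \<in> pos_vecs" using \<alpha> that by auto
      then have "entropy S (upd (upd (upd \<alpha> x t) y a) z b) =
          entropy S (upd (upd \<alpha> x t) y a) + entropy S (upd (upd \<alpha> x t) z b) - entropy S (upd \<alpha> x t)"
        using entropy_additive_in[OF zero(1) yz] a b unfolding additive_in_def by blast
      then show ?thesis using 3 by (simp add: upd_commute[of x])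
    qed
    then have "(?\<phi> has_real_derivative 0) (at (\<alpha> $ x))"
      using x by (intro DERIV_cong_ev[THEN iffD1, OF refl _ refl DERIV_const[of 0]]
          eventually_mono[OF eventually_nhds_in_open[of "{0<..}"]]) auto
    moreover have "(?\<phi> has_real_derivative
       hom_ext S x (upd (upd (upd \<alpha> y a) z b) x (\<alpha> $ x)) - hom_ext S x (upd (upd \<alpha> y a) x (\<alpha> $ x))
      - hom_ext S x (upd (upd \<alpha> z b) x (\<alpha> $ x)) + hom_ext S x (upd \<alpha> x (\<alpha> $ x))) (at (\<alpha> $ x))"
      using \<alpha> a b x by (intro DERIV_diff DERIV_add entropy_partial_upd) auto
    ultimately have "hom_ext S x (upd (upd (upd \<alpha> y a) z b) x (\<alpha> $ x)) - hom_ext S x (upd (upd \<alpha> y a) x (\<alpha> $ x))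
      - hom_ext S x (upd (upd \<alpha> z b) x (\<alpha> $ x)) + hom_ext S x (upd \<alpha> x (\<alpha> $ x)) = 0"
      using DERIV_unique by blast
    moreover have "upd (upd (upd \<alpha> y a) z b) x (\<alpha> $ x) = upd (upd \<alpha> y a) z b"
      "upd (upd \<alpha> y a) x (\<alpha> $ x) = upd \<alpha> y a" "upd (upd \<alpha> z b) x (\<alpha> $ x) = upd \<alpha> z b"
      using 3 by (simp_all add: vec_eq_iff)
    ultimately show ?thesis by simp
  qed
qed

end

section \<open>Expansion over maximal cliques\<close>

definition patch :: "real \<Rightarrow> real ^ 'a::finite \<Rightarrow> 'a set \<Rightarrow> real ^ 'a" where
  "patch b \<alpha> B = (\<chi> x. if x \<in> B then \<alpha> $ x else b)"

lemma patch_UNIV [simp]: "patch b \<alpha> UNIV = \<alpha>"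
  by (simp add: patch_def vec_eq_iff)

lemma patch_pos [intro]: "\<alpha> \<in> pos_vecs \<Longrightarrow> b > 0 \<Longrightarrow> patch b \<alpha> B \<in> pos_vecs"
  by (simp add: patch_def pos_vecs_def)

lemma patch_cong: "(\<And>x. x \<in> B \<Longrightarrow> \<alpha> $ x = \<beta> $ x) \<Longrightarrow> patch b \<alpha> B = patch b \<beta> B"
  by (simp add: patch_def vec_eq_iff)

lemma patch_split:
  assumes f: "additive_in f y z" and "y \<noteq> z" "\<alpha> \<in> pos_vecs" "b > 0"
  shows "f (patch b \<alpha> B) =
    f (patch b \<alpha> (B - {y})) + f (patch b \<alpha> (B - {z})) - f (patch b \<alpha> (B - {y, z}))"
proof -
  let ?\<beta> = "patch b \<alpha> B"
  have \<beta>: "?\<beta> \<in> pos_vecs" using assms by blast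
  then have p: "?\<beta> $ y > 0" "?\<beta> $ z > 0" by (simp_all add: pos_vecs_def)
  have "patch b \<alpha> (B - {y, z}) \<in> pos_vecs" using assms by blast
  then have "f (upd (upd (patch b \<alpha> (B - {y, z})) y (?\<beta> $ y)) z (?\<beta> $ z)) =
    f (upd (patch b \<alpha> (B - {y, z})) y (?\<beta> $ y)) + f (upd (patch b \<alpha> (B - {y, z})) z (?\<beta> $ z))
      - f (patch b \<alpha> (B - {y, z}))"
    using f p unfolding additive_in_def by blast
  moreover have "upd (upd (patch b \<alpha> (B - {y, z})) y (?\<beta> $ y)) z (?\<beta> $ z) = ?\<beta>"
    "upd (patch b \<alpha> (B - {y, z})) y (?\<beta> $ y) = patch b \<alpha> (B - {z})"
    "upd (patch b \<alpha> (B - {y, z})) z (?\<beta> $ z) = patch b \<alpha> (B - {y})"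
    using assms(2) by (auto simp: patch_def vec_eq_iff)
  ultimately show ?thesis by simp
qed

text \<open>
  Induction on the cardinality: a set that is not complete contains a non-adjacent pair, and the hypothesis
  replaces it by three smaller sets. The coefficients \<open>m\<close> do not depend on \<open>\<alpha>\<close>, so that the terms
  inherit linear properties of \<open>F\<close> such as homogeneity.
\<close>

lemma complete_subset_combination:
  fixes F :: "'a::finite set \<Rightarrow> 'b \<Rightarrow> real"
  assumes split: "\<And>B y z \<alpha>. y \<in> B \<Longrightarrow> z \<in> B \<Longrightarrow> y \<noteq> z \<Longrightarrow> \<not> E y z \<Longrightarrow> \<alpha> \<in> X \<Longrightarrow>
      F B \<alpha> = F (B - {y}) \<alpha> + F (B - {z}) \<alpha> - F (B - {y, z}) \<alpha>"
  shows "\<exists>m :: 'a set \<Rightarrow> real. \<forall>\<alpha>\<in>X. F A \<alpha> = (\<Sum>B | complete_subset E B. m B * F B \<alpha>)"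
proof (induction "card A" arbitrary: A rule: less_induct)
  case less
  show ?case
  proof (cases "complete_subset E A")
    case True
    then show ?thesis
      by (intro exI[of _ "\<lambda>B. if B = A then 1 else 0"]) (simp add: if_distrib[of "\<lambda>u. u * _"] cong: if_cong)
  next
    case False
    then obtain y z where yz: "y \<in> A" "z \<in> A" "y \<noteq> z" "\<not> E y z"
      by (auto simp: complete_subset_def)
    have "A - {y} \<subset> A" "A - {z} \<subset> A" "A - {y, z} \<subset> A" using yz by auto
    then have "card (A - {y}) < card A" "card (A - {z}) < card A" "card (A - {y, z}) < card A"
      by (simp_all only: psubset_card_mono finite)
    from less(1)[OF this(1)] less(1)[OF this(2)] less(1)[OF this(3)]
    obtain m1 m2 m3 :: "'a set \<Rightarrow> real" where
      m: "\<forall>\<alpha>\<in>X. F (A - {y}) \<alpha> = (\<Sum>B | complete_subset E B. m1 B * F B \<alpha>)"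
         "\<forall>\<alpha>\<in>X. F (A - {z}) \<alpha> = (\<Sum>B | complete_subset E B. m2 B * F B \<alpha>)"
         "\<forall>\<alpha>\<in>X. F (A - {y, z}) \<alpha> = (\<Sum>B | complete_subset E B. m3 B * F B \<alpha>)"
      by blast
    have "\<forall>\<alpha>\<in>X. F A \<alpha> = (\<Sum>B | complete_subset E B. (m1 B + m2 B - m3 B) * F B \<alpha>)"
      using split[OF yz] m by (simp add: algebra_simps sum.distrib sum_subtractf)
    then show ?thesis by (rule exI[of _ "\<lambda>B. m1 B + m2 B - m3 B"])
  qed
qed

lemma max_clique_above:
  fixes E :: "'a::finite \<Rightarrow> 'a \<Rightarrow> bool"
  assumes "complete_subset E B"
  shows "\<exists>C\<in>max_cliques E. B \<subseteq> C"
proof -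
  obtain C where "C \<in> {C. complete_subset E C}" "B \<subseteq> C"
    "\<forall>D\<in>{C. complete_subset E C}. C \<subseteq> D \<longrightarrow> C = D"
    using finite_has_maximal2[of "{C. complete_subset E C}" B] assms by auto
  then show ?thesis by (auto simp: max_cliques_def)
qed

text \<open>
  Each complete set is assigned to one maximal clique containing it, and \<open>h C\<close> collects the terms
  of the sets assigned to \<open>C\<close>.
\<close>

lemma clique_expansion:
  fixes F :: "'a::finite set \<Rightarrow> real ^ 'a \<Rightarrow> real"
  assumes split: "\<And>B y z \<alpha>. y \<in> B \<Longrightarrow> z \<in> B \<Longrightarrow> y \<noteq> z \<Longrightarrow> \<not> E y z \<Longrightarrow> \<alpha> \<in> pos_vecs \<Longrightarrow>
      F B \<alpha> = F (B - {y}) \<alpha> + F (B - {z}) \<alpha> - F (B - {y, z}) \<alpha>"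
    and dep: "\<And>B \<alpha> \<beta>. (\<And>x. x \<in> B \<Longrightarrow> \<alpha> $ x = \<beta> $ x) \<Longrightarrow> F B \<alpha> = F B \<beta>"
  shows "\<exists>h. (\<forall>\<alpha>\<in>pos_vecs. F UNIV \<alpha> = (\<Sum>C\<in>max_cliques E. h C (subvec \<alpha> C))) \<and>
    ((\<forall>B c. \<forall>\<alpha>\<in>pos_vecs. c > 0 \<longrightarrow> F B (c *\<^sub>R \<alpha>) = c * F B \<alpha>) \<longrightarrow>
       (\<forall>C. one_homogeneous_on C (h C)))"
proof -
  obtain m :: "'a set \<Rightarrow> real"
    where m: "\<And>\<alpha>. \<alpha> \<in> pos_vecs \<Longrightarrow> F UNIV \<alpha> = (\<Sum>B | complete_subset E B. m B * F B \<alpha>)"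
    using complete_subset_combination[of E pos_vecs F UNIV, OF split] by blast
  have "\<forall>B. \<exists>C. complete_subset E B \<longrightarrow> C \<in> max_cliques E \<and> B \<subseteq> C"
    using max_clique_above by blast
  then obtain K where K: "\<And>B. complete_subset E B \<Longrightarrow> K B \<in> max_cliques E \<and> B \<subseteq> K B"
    by (metis (full_types) choice)
  (* F B ignores coordinates outside B, so the value 1 off C is arbitrary; it keeps ext \<beta> C positive. *)
  define ext :: "('a \<Rightarrow> real) \<Rightarrow> 'a set \<Rightarrow> real ^ 'a" where "ext \<beta> C = (\<chi> x. if x \<in> C then \<beta> x else 1)" for \<beta> C
  define h where "h C \<beta> = (\<Sum>B | complete_subset E B \<and> K B = C. m B * F B (ext \<beta> C))" for C \<beta>
  have "F UNIV \<alpha> = (\<Sum>C\<in>max_cliques E. h C (subvec \<alpha> C))" if \<alpha>: "\<alpha> \<in> pos_vecs" for \<alpha>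
  proof -
    have "F B (ext (subvec \<alpha> (K B)) (K B)) = F B \<alpha>" if "complete_subset E B" for B
      using K[OF that] by (intro dep) (auto simp: ext_def subvec_def)
    then have "h C (subvec \<alpha> C) = (\<Sum>B | complete_subset E B \<and> K B = C. m B * F B \<alpha>)" for C
      unfolding h_def by (intro sum.cong) auto
    then have "(\<Sum>C\<in>max_cliques E. h C (subvec \<alpha> C)) = (\<Sum>B | complete_subset E B. m B * F B \<alpha>)"
      using sum.group[of "{B. complete_subset E B}" "max_cliques E" K "\<lambda>B. m B * F B \<alpha>"] K
      by (simp add: image_subset_iff)
    then show ?thesis using m[OF \<alpha>] by simp
  qed
  moreover have "one_homogeneous_on C (h C)"
    if hom: "\<forall>B c. \<forall>\<alpha>\<in>pos_vecs. c > 0 \<longrightarrow> F B (c *\<^sub>R \<alpha>) = c * F B \<alpha>" for C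
    unfolding one_homogeneous_on_def
  proof (intro allI impI ballI)
    fix c :: real and \<beta> :: "'a \<Rightarrow> real"
    assume c: "c > 0" and "\<beta> \<in> pos_subvecs C"
    then have pos: "ext \<beta> C \<in> pos_vecs" by (auto simp: pos_subvecs_def subvec_def ext_def pos_vecs_def)
    have "F B (ext (\<lambda>x\<in>C. c * \<beta> x) C) = c * F B (ext \<beta> C)" if "complete_subset E B" "K B = C" for B
    proof -
      have "F B (ext (\<lambda>x\<in>C. c * \<beta> x) C) = F B (c *\<^sub>R ext \<beta> C)"
        using K[OF that(1)] that(2) by (intro dep) (auto simp: ext_def)
      then show ?thesis using hom pos c by simp
    qed
    then show "h C (\<lambda>x\<in>C. c * \<beta> x) = c * h C \<beta>"
      unfolding h_def sum_distrib_left by (intro sum.cong) auto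
  qed
  ultimately show ?thesis by blast
qed

lemma additive_clique_expansion:
  fixes f :: "real ^ 'a::finite \<Rightarrow> real"
  assumes "\<And>y z. y \<noteq> z \<Longrightarrow> \<not> E y z \<Longrightarrow> additive_in f y z"
  shows "\<exists>h. \<forall>\<alpha>\<in>pos_vecs. f \<alpha> = (\<Sum>C\<in>max_cliques E. h C (subvec \<alpha> C))"
proof -
  have 1: "f (patch 1 \<alpha> B) =
    f (patch 1 \<alpha> (B - {y})) + f (patch 1 \<alpha> (B - {z})) - f (patch 1 \<alpha> (B - {y, z}))"
    if "y \<noteq> z" "\<not> E y z" "\<alpha> \<in> pos_vecs" for B y z \<alpha>
    by (rule patch_split) (use assms that in auto)
  have 2: "f (patch 1 \<alpha> B) = f (patch 1 \<beta> B)" if "\<And>x. x \<in> B \<Longrightarrow> \<alpha> $ x = \<beta> $ x" for B \<alpha> \<beta>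
    using patch_cong[OF that] by simp
  from clique_expansion[of E "\<lambda>B \<alpha>. f (patch 1 \<alpha> B)", OF 1 2] show ?thesis
    by simp blast
qed

section \<open>Homogeneous expansion of a regular entropy\<close>

text \<open>
  The limit superior along the segment is at most \<open>L\<close>, because the segment approaches \<open>\<alpha>\<close> through the positive
  orthant. For the converse, concavity bounds \<open>H\<close> from below on the segments from \<open>\<gamma>\<close> to positive points
  \<open>\<beta>\<close> near \<open>\<alpha>\<close> with \<open>H \<beta>\<close> almost \<open>L\<close>; continuity in the interior transfers the bound to the segment from
  \<open>\<gamma>\<close> to \<open>\<alpha>\<close>.
\<close>

lemma concave_limit_eq_closure:
  fixes H :: "real ^ 'a::finite \<Rightarrow> real"
  assumes cont: "continuous_on pos_vecs H"
    and concave: "\<And>\<alpha> \<beta> t. \<alpha> \<in> pos_vecs \<Longrightarrow> \<beta> \<in> pos_vecs \<Longrightarrow> 0 < t \<Longrightarrow> t < 1 \<Longrightarrow>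
        (1 - t) * H \<alpha> + t * H \<beta> \<le> H ((1 - t) *\<^sub>R \<alpha> + t *\<^sub>R \<beta>)"
    and \<alpha>: "\<alpha> \<in> nonneg_vecs" and \<gamma>: "\<gamma> \<in> pos_vecs"
    and L: "concave_closure pos_vecs H \<alpha> = ereal L"
  shows "((\<lambda>t. H ((1 - t) *\<^sub>R \<alpha> + t *\<^sub>R \<gamma>)) \<longlongrightarrow> L) (at_right 0)"
proof -
  define F where "F = inf (nhds \<alpha>) (principal (pos_vecs :: (real ^ 'a) set))"
  define g where "g t = (1 - t) *\<^sub>R \<alpha> + t *\<^sub>R \<gamma>" for t :: real
  have L': "Limsup F (\<lambda>\<beta>. ereal (H \<beta>)) = ereal L" using L by (simp add: concave_closure_def F_def)
  have g_pos: "g t \<in> pos_vecs" if "0 < t" "t < 1" for t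
    using \<alpha> \<gamma> that by (auto simp: g_def pos_vecs_def nonneg_vecs_def intro!: add_nonneg_pos)
  have small: "\<forall>\<^sub>F t in at_right (0::real). 0 < t \<and> t < 1"
    using eventually_at_right_real[of 0 1] by simp
  have lower: "(1 - t) * L + t * H \<gamma> \<le> H (g t)" if t: "0 < t" "t < 1" for t
  proof (rule ccontr)
    assume "\<not> ?thesis"
    then obtain e where e: "e > 0" "H (g t) < (1 - t) * L + t * H \<gamma> - e"
      by (metis diff_gt_0_iff_gt field_lbound_gt_zero less_diff_eq not_le add.commute)
    have "((\<lambda>\<beta>. (1 - t) *\<^sub>R \<beta> + t *\<^sub>R \<gamma>) \<longlongrightarrow> g t) F"
      unfolding g_def F_def by (intro tendsto_intros tendsto_mono[OF inf_le1]) (simp add: filterlim_ident)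
    then have "((\<lambda>\<beta>. H ((1 - t) *\<^sub>R \<beta> + t *\<^sub>R \<gamma>)) \<longlongrightarrow> H (g t)) F"
      by (rule continuous_on_tendsto_compose[OF cont _ g_pos[OF t]])
        (use t \<gamma> in \<open>auto simp: F_def eventually_inf_principal pos_vecs_def intro!: always_eventually add_pos_pos\<close>)
    from order_tendstoD(2)[OF this e(2)]
    have "\<forall>\<^sub>F \<beta> in F. H ((1 - t) *\<^sub>R \<beta> + t *\<^sub>R \<gamma>) < (1 - t) * L + t * H \<gamma> - e" .
    moreover have "\<forall>\<^sub>F \<beta> in F. \<beta> \<in> pos_vecs" by (simp add: F_def eventually_inf_principal)
    ultimately have "\<forall>\<^sub>F \<beta> in F. ereal (H \<beta>) \<le> ereal (L - e / (1 - t))"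
    proof eventually_elim
      case (elim \<beta>)
      then have "(1 - t) * H \<beta> < (1 - t) * L - e"
        using concave[OF elim(2) \<gamma> t] by linarith
      then show ?case using t by (simp add: field_simps)
    qed
    then have "ereal L \<le> ereal (L - e / (1 - t))"
      using Limsup_bounded L' by metis
    then show False using t e by (simp add: field_simps)
  qed
  have "(g \<longlongrightarrow> (1 - 0) *\<^sub>R \<alpha> + 0 *\<^sub>R \<gamma>) (at_right 0)"
    unfolding g_def by (intro tendsto_intros)
  then have gF: "filterlim g F (at_right 0)"
    using small unfolding F_def
    by (auto simp: filterlim_inf filterlim_principal elim!: eventually_mono intro!: g_pos)
  show ?thesis
  proof (rule order_tendstoI)
    fix a assume a: "a < L"
    have "((\<lambda>t. (1 - t) * L + t * H \<gamma>) \<longlongrightarrow> (1 - 0) * L + 0 * H \<gamma>) (at_right 0)"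
      by (intro tendsto_intros)
    then have "\<forall>\<^sub>F t in at_right 0. a < (1 - t) * L + t * H \<gamma>"
      using a by (intro order_tendstoD(1)[of _ L]) simp_all
    then show "\<forall>\<^sub>F t in at_right 0. a < H ((1 - t) *\<^sub>R \<alpha> + t *\<^sub>R \<gamma>)"
      using small by eventually_elim (use lower in \<open>fastforce simp: g_def\<close>)
  next
    fix a assume "L < a"
    then have "\<forall>\<^sub>F \<beta> in F. ereal (H \<beta>) < ereal a" using L' by (intro Limsup_lessD) simp
    then have "\<forall>\<^sub>F t in at_right 0. ereal (H (g t)) < ereal a"
      using gF by (rule eventually_compose_filterlim)
    then show "\<forall>\<^sub>F t in at_right 0. H ((1 - t) *\<^sub>R \<alpha> + t *\<^sub>R \<gamma>) < a"
      by (simp add: g_def)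
  qed
qed

context smooth_proper_score
begin

lemma entropy_concave:
  assumes "\<alpha> \<in> pos_vecs" "\<beta> \<in> pos_vecs" "0 < t" "t < 1"
  shows "(1 - t) * entropy S \<alpha> + t * entropy S \<beta> \<le> entropy S ((1 - t) *\<^sub>R \<alpha> + t *\<^sub>R \<beta>)"
proof -
  let ?\<gamma> = "(1 - t) *\<^sub>R \<alpha> + t *\<^sub>R \<beta>"
  have \<gamma>: "?\<gamma> \<in> pos_vecs" using assms by (auto simp: pos_vecs_def intro!: add_pos_pos)
  have "(1 - t) * entropy S \<alpha> + t * entropy S \<beta> \<le>
      (1 - t) * (\<Sum>x\<in>UNIV. \<alpha> $ x * hom_ext S x ?\<gamma>) + t * (\<Sum>x\<in>UNIV. \<beta> $ x * hom_ext S x ?\<gamma>)"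
    using assms by (intro add_mono mult_left_mono entropy_le \<gamma>) auto
  also have "\<dots> = entropy S ?\<gamma>"
    unfolding entropy_def sum_distrib_left sum.distrib[symmetric]
    by (intro sum.cong) (auto simp: algebra_simps)
  finally show ?thesis .
qed

text \<open>
  The patched vectors run along the segment from \<open>patch 0 \<alpha> B\<close>, in the closed orthant, to \<open>patch 1 \<alpha> B\<close>.
\<close>

lemma entropy_patch_limit:
  assumes reg: "regular_entropy (entropy S)" and \<alpha>: "\<alpha> \<in> pos_vecs"
  shows "\<exists>L. ((\<lambda>t. entropy S (patch t \<alpha> B)) \<longlongrightarrow> L) (at_right 0)"
proof -
  have 0: "patch 0 \<alpha> B \<in> nonneg_vecs"
    using \<alpha> by (auto simp: patch_def nonneg_vecs_def pos_vecs_def less_imp_le)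
  then obtain L where L: "concave_closure pos_vecs (entropy S) (patch 0 \<alpha> B) = ereal L"
    using reg unfolding regular_entropy_def by (metis ereal_real)
  have "(1 - t) *\<^sub>R patch 0 \<alpha> B + t *\<^sub>R patch 1 \<alpha> B = patch t \<alpha> B" for t
    by (simp add: patch_def vec_eq_iff algebra_simps)
  then show ?thesis
    using concave_limit_eq_closure[OF _ entropy_concave 0 patch_pos[OF \<alpha>, of 1 B] L] reg
    by (auto simp: regular_entropy_def)
qed

text \<open>
  Scaling \<open>\<alpha>\<close> by \<open>c\<close> amounts to scaling the patched vector and replacing the base value \<open>t\<close> by \<open>t / c\<close>. In the
  limit \<open>t \<rightarrow> 0\<close> the base value no longer matters, so the limits are homogeneous.
\<close>

lemma homogeneous_clique_expansion:
  assumes reg: "regular_entropy (entropy S)"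
    and add: "\<And>y z. y \<noteq> z \<Longrightarrow> \<not> E y z \<Longrightarrow> additive_in (entropy S) y z"
  shows "\<exists>h. (\<forall>\<alpha>\<in>pos_vecs. entropy S \<alpha> = (\<Sum>C\<in>max_cliques E. h C (subvec \<alpha> C))) \<and>
    (\<forall>C. one_homogeneous_on C (h C))"
proof -
  define F where "F B \<alpha> = Lim (at_right 0) (\<lambda>t. entropy S (patch t \<alpha> B))" for B \<alpha>
  have lim: "((\<lambda>t. entropy S (patch t \<alpha> B)) \<longlongrightarrow> F B \<alpha>) (at_right 0)" if "\<alpha> \<in> pos_vecs" for B \<alpha>
    using entropy_patch_limit[OF reg that, of B] unfolding F_def
    by (metis tendsto_Lim trivial_limit_at_right_real)
  have F_UNIV: "F UNIV \<alpha> = entropy S \<alpha>" for \<alpha>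
    unfolding F_def by (simp add: tendsto_Lim)
  have split: "F B \<alpha> = F (B - {y}) \<alpha> + F (B - {z}) \<alpha> - F (B - {y, z}) \<alpha>"
    if yz: "y \<noteq> z" "\<not> E y z" and \<alpha>: "\<alpha> \<in> pos_vecs" for B y z \<alpha>
  proof (rule tendsto_unique[OF trivial_limit_at_right_real lim[OF \<alpha>]])
    have "\<forall>\<^sub>F t in at_right (0::real). t > 0"
      using eventually_at_right_real[of 0 1] by (auto elim: eventually_mono)
    then have "\<forall>\<^sub>F t in at_right 0. entropy S (patch t \<alpha> (B - {y})) + entropy S (patch t \<alpha> (B - {z}))
        - entropy S (patch t \<alpha> (B - {y, z})) = entropy S (patch t \<alpha> B)"
      by eventually_elim (rule patch_split[OF add[OF yz] yz(1) \<alpha>, symmetric])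
    moreover have "((\<lambda>t. entropy S (patch t \<alpha> (B - {y})) + entropy S (patch t \<alpha> (B - {z}))
        - entropy S (patch t \<alpha> (B - {y, z}))) \<longlongrightarrow> F (B - {y}) \<alpha> + F (B - {z}) \<alpha> - F (B - {y, z}) \<alpha>) (at_right 0)"
      by (intro tendsto_intros lim \<alpha>)
    ultimately show "((\<lambda>t. entropy S (patch t \<alpha> B)) \<longlongrightarrow>
        F (B - {y}) \<alpha> + F (B - {z}) \<alpha> - F (B - {y, z}) \<alpha>) (at_right 0)"
      by (rule Lim_transform_eventually[rotated])
  qed
  have dep: "F B \<alpha> = F B \<beta>" if "\<And>x. x \<in> B \<Longrightarrow> \<alpha> $ x = \<beta> $ x" for B \<alpha> \<beta>
    unfolding F_def using patch_cong[OF that] by simp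
  have hom: "F B (c *\<^sub>R \<alpha>) = c * F B \<alpha>" if \<alpha>: "\<alpha> \<in> pos_vecs" and c: "c > 0" for B c \<alpha>
  proof (rule tendsto_unique[OF trivial_limit_at_right_real lim[OF scale_pos[OF \<alpha> c]]])
    have "patch t (c *\<^sub>R \<alpha>) B = c *\<^sub>R patch (t / c) \<alpha> B" for t
      using c by (simp add: patch_def vec_eq_iff)
    then have "entropy S (patch t (c *\<^sub>R \<alpha>) B) = c * entropy S (patch (t / c) \<alpha> B)" for t
      using entropy_scale[OF c] by simp
    moreover have "filterlim (\<lambda>t. t / c) (at_right 0) (at_right 0)"
    proof -
      have "((\<lambda>t. t / c) \<longlongrightarrow> 0 / c) (at_right 0)" using c by (intro tendsto_intros) auto
      moreover have "\<forall>\<^sub>F t in at_right 0. t / c \<in> {0<..} \<and> t / c \<noteq> 0"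
        using eventually_at_right_real[of 0 1] c by (auto elim: eventually_mono)
      ultimately show ?thesis by (simp add: filterlim_at)
    qed
    ultimately show "((\<lambda>t. entropy S (patch t (c *\<^sub>R \<alpha>) B)) \<longlongrightarrow> c * F B \<alpha>) (at_right 0)"
      using tendsto_mult_left[OF filterlim_compose[OF lim[OF \<alpha>]], of "\<lambda>t. t / c"] by simp
  qed
  from clique_expansion[of E F, OF split dep] hom show ?thesis
    unfolding F_UNIV by blast
qed

end

section \<open>The clique expansion theorem\<close>

theorem theorem5p5:
  fixes E :: "'a::finite \<Rightarrow> 'a \<Rightarrow> bool"
    and S :: "'a \<Rightarrow> real ^ 'a \<Rightarrow> real"
  assumes "symp E" and "irreflp E"
    and "disjointness_condition E"
    and "proper_score S"
    and "cont_diff_score S"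
    and "key_local E S"
  shows "(\<exists>(s :: 'a set \<Rightarrow> ('a \<Rightarrow> real) \<Rightarrow> real ^ 'a) (h :: 'a set \<Rightarrow> ('a \<Rightarrow> real) \<Rightarrow> real).
            \<forall>\<alpha>\<in>pos_vecs.
              score_vec S \<alpha> = (\<Sum>C\<in>max_cliques E. s C (subvec \<alpha> C)) \<and>
              entropy S \<alpha> = (\<Sum>C\<in>max_cliques E. h C (subvec \<alpha> C))) \<and>
         (regular_entropy (entropy S) \<longrightarrow>
            (\<exists>h :: 'a set \<Rightarrow> ('a \<Rightarrow> real) \<Rightarrow> real.
              (\<forall>\<alpha>\<in>pos_vecs. entropy S \<alpha> = (\<Sum>C\<in>max_cliques E. h C (subvec \<alpha> C))) \<and>
              (\<forall>C\<in>max_cliques E. one_homogeneous_on C (h C))))"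
proof -
  obtain D :: "'a \<Rightarrow> real ^ 'a \<Rightarrow> (real ^ 'a) \<Rightarrow>\<^sub>L real" where
    D: "\<And>x. continuous_on pos_probs (D x)"
       "\<And>x p. p \<in> pos_probs \<Longrightarrow> (S x has_derivative blinfun_apply (D x p)) (at p within pos_probs)"
    using assms(5) unfolding cont_diff_score_def by metis
  interpret smooth_proper_score S D
    by standard (use assms(4) D in auto)
  obtain s where s: "local_repr E S s"
    "\<And>p y. p \<in> pos_probs \<Longrightarrow> (\<Sum>x\<in>UNIV. p $ x * local_partial E s x y p) = 0"
    using assms(6) by (auto simp: key_local_def)
  have zero: "score_partial x y \<beta> = 0" if "x \<noteq> y" "\<not> E x y" "\<beta> \<in> pos_vecs" for x y \<beta>
    using score_partial_nonadjacent[OF assms(1,3) s that(3), of y x] that(1,2) by (auto simp: nbhd_def)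
  have zero': "score_partial y x \<beta> = 0" if "x \<noteq> y" "\<not> E x y" "\<beta> \<in> pos_vecs" for x y \<beta>
    using zero[of y x \<beta>] that assms(1) by (auto dest: sympD)
  have H: "additive_in (entropy S) y z" if "y \<noteq> z" "\<not> E y z" for y z
    using entropy_additive_in[OF zero] that by blast
  have "\<exists>h. \<forall>\<alpha>\<in>pos_vecs. hom_ext S x \<alpha> = (\<Sum>C\<in>max_cliques E. h C (subvec \<alpha> C))" for x
    by (rule additive_clique_expansion) (use hom_ext_additive_in zero zero' in blast)
  then obtain k where k: "\<And>x \<alpha>. \<alpha> \<in> pos_vecs \<Longrightarrow>
      hom_ext S x \<alpha> = (\<Sum>C\<in>max_cliques E. k x C (subvec \<alpha> C))"
    by metis
  obtain h where h: "\<And>\<alpha>. \<alpha> \<in> pos_vecs \<Longrightarrow> entropy S \<alpha> = (\<Sum>C\<in>max_cliques E. h C (subvec \<alpha> C))"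
    using additive_clique_expansion[of E, OF H] by blast
  have "\<forall>\<alpha>\<in>pos_vecs. score_vec S \<alpha> = (\<Sum>C\<in>max_cliques E. \<chi> x. k x C (subvec \<alpha> C)) \<and>
      entropy S \<alpha> = (\<Sum>C\<in>max_cliques E. h C (subvec \<alpha> C))"
    using k h by (simp add: score_vec_def vec_eq_iff)
  then have "\<exists>(s :: 'a set \<Rightarrow> ('a \<Rightarrow> real) \<Rightarrow> real ^ 'a) (h :: 'a set \<Rightarrow> ('a \<Rightarrow> real) \<Rightarrow> real).
      \<forall>\<alpha>\<in>pos_vecs. score_vec S \<alpha> = (\<Sum>C\<in>max_cliques E. s C (subvec \<alpha> C)) \<and>
        entropy S \<alpha> = (\<Sum>C\<in>max_cliques E. h C (subvec \<alpha> C))"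
    by (intro exI[of _ "\<lambda>C \<beta>. \<chi> x. k x C \<beta>"] exI[of _ h])
  moreover have "\<exists>h. (\<forall>\<alpha>\<in>pos_vecs. entropy S \<alpha> = (\<Sum>C\<in>max_cliques E. h C (subvec \<alpha> C))) \<and>
      (\<forall>C\<in>max_cliques E. one_homogeneous_on C (h C))" if "regular_entropy (entropy S)"
    using homogeneous_clique_expansion[of E, OF that H] by blast
  ultimately show ?thesis by simp
qed

end
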